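(* Let $*:\hat S\to\widehat{{}^*S}$ be an enlargement, and let $\mathcal C$ be an $\hat S$-small category. Then ${}^*\mathcal C$ is a $\widehat{{}^*S}$-small category with $\mathrm{Mor}_{{}^*\mathcal C}={}^*\mathrm{Mor}_{\mathcal C}$ (so in particular all morphisms in ${}^*\mathcal C$ are internal).
   Context: Superstructures: a base set $S$ is an infinite set whose elements are not sets; $S_0=S$, $S_n=S_{n-1}\cup\mathcal P(S_{n-1})$, and $\hat S=\bigcup_{n\ge 0}S_n$ is the superstructure over $S$. A formula in $\hat S$ is built from atomic formulas $s=t$, $s\in t$ (with $s,t$ terms built from variables, constants in $\hat S$, ordered pairs $\langle s,t\rangle$ and function application) by means of $\neg$, $\wedge$ and bounded quantifiers $\forall x\in t$ (and the usual abbreviations); a statement is a formula without free variables. For a map $\tau\mapsto{}^*\tau$ from $\hat S$ to a superstructure $\hat W$, ${}^*\varphi$ denotes the formula obtained from $\varphi$ by replacing each constant $\tau$ by ${}^*\tau$. Enlargement: a map $*:\hat S\to\hat W$ between superstructures with (1) ${}^*S=W$; (2) ${}^*s=s$ for $s\in S$; (3) (transfer) a statement $\varphi$ in $\hat S$ is true iff ${}^*\varphi$ is true; (4) (saturation) with $\mathcal I=\bigcup_{A\in\hat S\setminus S}{}^*A$, every nonempty family $\{U_i\}_{i\in I}$ of nonempty sets $U_i\in\mathcal I$ with $|I|\le|\hat S|$ and the finite intersection property has nonempty intersection. Elements of $\mathcal I$ are called internal. $\hat S$-small category: a quadruple $\mathcal C=\langle M,s,t,c\rangle$ with $M\in\hat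 S\setminus S$; maps $s,t:M\to M$ with $ss=ts=s$, $st=tt=t$; $c\subseteq M\times M\times M$ such that $\langle f,g,h\rangle\in c$ implies $sf=tg$, $tf=th$, $sg=sh$, and for all $f,g\in M$ with $sf=tg$ there is a unique $h\in M$ with $\langle f,g,h\rangle\in c$; $\langle f,tf,f\rangle$... that is, with the intended reading, the identities $sf$ and $tf$ are units for composition; and $c$ is associative. Here $M=\mathrm{Mor}_{\mathcal C}$ is the set of morphisms, $\mathrm{Ob}(\mathcal C)=s(M)$ (objects are identified with their identity morphisms), $\mathrm{Mor}_{\mathcal C}(X,Y)=\{f\in M: sf=X, tf=Y\}$, and $\langle f,g,h\rangle\in c$ means $f\circ g=h$. The same definition with $S$ replaced by ${}^*S$ gives $\widehat{{}^*S}$-small categories. For an $\hat S$-small category $\mathcal C=\langle M,s,t,c\rangle$, ${}^*\mathcal C=\langle{}^*M,{}^*s,{}^*t,{}^*c\rangle$. *)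

theory Defs
  imports Main "HOL-Library.Equipollence"
begin

text \<open>
  The ambient set theory with urelements: a type carrying a membership relation, in which atoms
  (non-sets) are allowed.  Separation is second order, so a set has all its subcollections as
  subsets and the power sets below are full power sets.  A superstructure over an infinite base
  set has at least beth-omega many elements, so it cannot be built inside a fixed HOL type
  expression; the type is therefore a parameter, specified by the axioms of extensionality,
  pairing, union, power set and separation.
\<close>

class set_universe =
  fixes atom :: "'a \<Rightarrow> bool"
    and elts :: "'a \<Rightarrow> 'a set"
  assumes elts_atom: "atom x \<Longrightarrow> elts x = {}"
    and extensionality: "\<not> atom x \<Longrightarrow> \<not> atom y \<Longrightarrow> elts x = elts y \<Longrightarrow> x = y"
    and pairing: "\<exists>z. \<not> atom z \<and> elts z = {x, y}"
    and union: "\<exists>z. \<not> atom z \<and> elts z = (\<Union>y\<in>elts x. elts y)"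
    and power_set: "\<exists>z. \<not> atom z \<and> elts z = {y. \<not> atom y \<and> elts y \<subseteq> elts x}"
    and separation: "\<exists>z. \<not> atom z \<and> elts z = {y \<in> elts x. P y}"

text \<open>Only meaningful when \<open>X\<close> is the extension of some set.\<close>
definition set_of :: "'v set \<Rightarrow> 'v::set_universe" where
  "set_of X = (THE z. \<not> atom z \<and> elts z = X)"

definition pair :: "'v \<Rightarrow> 'v \<Rightarrow> 'v::set_universe" where
  "pair a b = set_of {set_of {a}, set_of {a, b}}"

definition triple :: "'v \<Rightarrow> 'v \<Rightarrow> 'v \<Rightarrow> 'v::set_universe" where
  "triple a b c = pair (pair a b) c"

text \<open>Function application, made total by returning the empty set when \<open>f\<close> has no unique value
  at \<open>a\<close>; this is the reading of application terms in formulas.\<close>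
definition app :: "'v \<Rightarrow> 'v \<Rightarrow> 'v::set_universe" where
  "app f a = (if \<exists>!b. pair a b \<in> elts f then THE b. pair a b \<in> elts f else set_of {})"

definition is_map :: "'v::set_universe \<Rightarrow> 'v \<Rightarrow> 'v \<Rightarrow> bool" where
  "is_map f A B \<longleftrightarrow> \<not> atom f \<and>
     elts f \<subseteq> {pair a b | a b. a \<in> elts A \<and> b \<in> elts B} \<and>
     (\<forall>a\<in>elts A. \<exists>!b. pair a b \<in> elts f)"


section \<open>Superstructures\<close>

definition base_set :: "'v::set_universe \<Rightarrow> bool" where
  "base_set S \<longleftrightarrow> \<not> atom S \<and> infinite (elts S) \<and> (\<forall>x\<in>elts S. atom x)"

fun level :: "'v::set_universe \<Rightarrow> nat \<Rightarrow> 'v set" where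
  "level S 0 = elts S"
| "level S (Suc n) = level S n \<union> {A. \<not> atom A \<and> elts A \<subseteq> level S n}"

definition hat :: "'v::set_universe \<Rightarrow> 'v set" where
  "hat S = (\<Union>n. level S n)"


section \<open>Formulas\<close>

datatype 'c tm =
    Var nat
  | Const 'c
  | Pair "'c tm" "'c tm"
  | App "'c tm" "'c tm"

datatype 'c fm =
    Eq "'c tm" "'c tm"
  | Mem "'c tm" "'c tm"
  | Neg "'c fm"
  | And "'c fm" "'c fm"
  | BAll nat "'c tm" "'c fm"

primrec fv_tm :: "'c tm \<Rightarrow> nat set" where
  "fv_tm (Var i) = {i}"
| "fv_tm (Const c) = {}"
| "fv_tm (Pair s t) = fv_tm s \<union> fv_tm t"
| "fv_tm (App s t) = fv_tm s \<union> fv_tm t"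

text \<open>In a quantifier \<open>BAll i t \<phi>\<close> the variable \<open>i\<close> is bound in \<open>\<phi>\<close> but not in the bound \<open>t\<close>.\<close>
primrec fv :: "'c fm \<Rightarrow> nat set" where
  "fv (Eq s t) = fv_tm s \<union> fv_tm t"
| "fv (Mem s t) = fv_tm s \<union> fv_tm t"
| "fv (Neg \<phi>) = fv \<phi>"
| "fv (And \<phi> \<psi>) = fv \<phi> \<union> fv \<psi>"
| "fv (BAll i t \<phi>) = fv_tm t \<union> (fv \<phi> - {i})"

primrec eval :: "(nat \<Rightarrow> 'v) \<Rightarrow> 'v tm \<Rightarrow> 'v::set_universe" where
  "eval e (Var i) = e i"
| "eval e (Const c) = c"
| "eval e (Pair s t) = pair (eval e s) (eval e t)"
| "eval e (App s t) = app (eval e s) (eval e t)"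

text \<open>All quantifiers are bounded and superstructures are transitive, so satisfaction in the
  ambient universe is satisfaction in the superstructure containing the constants.\<close>
primrec sat :: "(nat \<Rightarrow> 'v::set_universe) \<Rightarrow> 'v fm \<Rightarrow> bool" where
  "sat e (Eq s t) \<longleftrightarrow> eval e s = eval e t"
| "sat e (Mem s t) \<longleftrightarrow> eval e s \<in> elts (eval e t)"
| "sat e (Neg \<phi>) \<longleftrightarrow> \<not> sat e \<phi>"
| "sat e (And \<phi> \<psi>) \<longleftrightarrow> sat e \<phi> \<and> sat e \<psi>"
| "sat e (BAll i t \<phi>) \<longleftrightarrow> (\<forall>a\<in>elts (eval e t). sat (e(i := a)) \<phi>)"

text \<open>\<open>set_fm \<phi>\<close> is the set of constants occurring in \<open>\<phi>\<close>.\<close>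
definition statement_in :: "'v::set_universe \<Rightarrow> 'v fm \<Rightarrow> bool" where
  "statement_in S \<phi> \<longleftrightarrow> set_fm \<phi> \<subseteq> hat S \<and> fv \<phi> = {}"

text \<open>Intended for formulas without free variables, where the assignment is irrelevant.\<close>
definition holds :: "'v::set_universe fm \<Rightarrow> bool" where
  "holds \<phi> \<longleftrightarrow> (\<forall>e. sat e \<phi>)"


section \<open>Enlargements\<close>

definition internal :: "'v::set_universe \<Rightarrow> ('v \<Rightarrow> 'v) \<Rightarrow> 'v set" where
  "internal S star = (\<Union>A\<in>hat S - elts S. elts (star A))"

text \<open>Transfer: \<open>map_fm star \<phi>\<close> replaces each constant \<open>\<tau>\<close> of \<open>\<phi>\<close> by \<open>star \<tau>\<close>.\<close>
definition transfer_principle :: "'v::set_universe \<Rightarrow> ('v \<Rightarrow> 'v) \<Rightarrow> bool" where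
  "transfer_principle S star \<longleftrightarrow>
     (\<forall>\<phi>. statement_in S \<phi> \<longrightarrow> (holds \<phi> \<longleftrightarrow> holds (map_fm star \<phi>)))"

text \<open>The index set may be taken inside the universe, since it injects into \<open>hat S\<close>.\<close>
definition saturation_principle :: "'v::set_universe \<Rightarrow> ('v \<Rightarrow> 'v) \<Rightarrow> bool" where
  "saturation_principle S star \<longleftrightarrow>
     (\<forall>(I :: 'v set) (U :: 'v \<Rightarrow> 'v).
        I \<noteq> {} \<longrightarrow> I \<lesssim> hat S \<longrightarrow>
        (\<forall>i\<in>I. U i \<in> internal S star \<and> \<not> atom (U i) \<and> elts (U i) \<noteq> {}) \<longrightarrow>
        (\<forall>J. J \<subseteq> I \<and> finite J \<and> J \<noteq> {} \<longrightarrow> (\<Inter>j\<in>J. elts (U j)) \<noteq> {}) \<longrightarrow>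
        (\<Inter>i\<in>I. elts (U i)) \<noteq> {})"

text \<open>\<open>star\<close> is a total HOL function; only its values on \<open>hat S\<close> matter.\<close>
definition enlargement :: "'v::set_universe \<Rightarrow> 'v \<Rightarrow> ('v \<Rightarrow> 'v) \<Rightarrow> bool" where
  "enlargement S W star \<longleftrightarrow>
     base_set S \<and> base_set W \<and> star ` hat S \<subseteq> hat W \<and>
     star S = W \<and> (\<forall>s\<in>elts S. star s = s) \<and>
     transfer_principle S star \<and> saturation_principle S star"


section \<open>Small categories\<close>

record 'v cat =
  Mor :: 'v
  src :: 'v
  tgt :: 'v
  cmp :: 'v

text \<open>\<open>triple f g h \<in> elts (cmp C)\<close> means \<open>f \<circ> g = h\<close>.\<close>
definition small_category :: "'v::set_universe \<Rightarrow> 'v cat \<Rightarrow> bool" where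
  "small_category S C \<longleftrightarrow>
     (let M = Mor C; s = app (src C); t = app (tgt C); c = elts (cmp C) in
        M \<in> hat S - elts S \<and>
        is_map (src C) M M \<and> is_map (tgt C) M M \<and>
        (\<forall>f\<in>elts M. s (s f) = s f \<and> t (s f) = s f \<and> s (t f) = t f \<and> t (t f) = t f) \<and>
        \<not> atom (cmp C) \<and>
        c \<subseteq> {triple f g h | f g h. f \<in> elts M \<and> g \<in> elts M \<and> h \<in> elts M} \<and>
        (\<forall>f\<in>elts M. \<forall>g\<in>elts M. \<forall>h\<in>elts M.
           triple f g h \<in> c \<longrightarrow> s f = t g \<and> t f = t h \<and> s g = s h) \<and>
        (\<forall>f\<in>elts M. \<forall>g\<in>elts M. s f = t g \<longrightarrow> (\<exists>!h. h \<in> elts M \<and> triple f g h \<in> c)) \<and>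
        (\<forall>f\<in>elts M. triple f (s f) f \<in> c \<and> triple (t f) f f \<in> c) \<and>
        (\<forall>f\<in>elts M. \<forall>g\<in>elts M. \<forall>h\<in>elts M. \<forall>u\<in>elts M. \<forall>v\<in>elts M. \<forall>w\<in>elts M.
           triple f g u \<in> c \<longrightarrow> triple g h v \<in> c \<longrightarrow> (triple u h w \<in> c \<longleftrightarrow> triple f v w \<in> c)))"

definition star_cat :: "('v \<Rightarrow> 'v) \<Rightarrow> 'v cat \<Rightarrow> 'v cat" where
  "star_cat star C =
     \<lparr>Mor = star (Mor C), src = star (src C), tgt = star (tgt C), cmp = star (cmp C)\<rparr>"

end

theory Submission
  imports Defs
begin

text \<open>
  The axioms of a small category that concern only the elements of \<open>M\<close>, \<open>s\<close>, \<open>t\<close>, \<open>c\<close> form a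
  single bounded sentence in the four constants \<open>M\<close>, \<open>s\<close>, \<open>t\<close>, \<open>c\<close> (\<open>small_category_iff_sat\<close>): every
  quantifier in them ranges over \<open>M\<close>, \<open>s\<close>, \<open>t\<close> or \<open>c\<close>, once the unbounded \<open>\<exists>!b\<close> in the definition
  of a map is relativised to the codomain, which is harmless because ordered pairs determine their
  components.  The four constants belong to the superstructure: \<open>M\<close> does by assumption, and
  \<open>s\<close>, \<open>t\<close>, \<open>c\<close> consist of pairs or triples of elements of \<open>M\<close>, so they are sets lying finitely
  many levels above \<open>M\<close>.  Hence the sentence transfers to the images of the four constants.

  What a sentence about elements cannot express is that the four images are sets and not atoms.
  This follows by transferring \<open>A \<notin> S\<close>: an element of a superstructure that is not in the base set
  is a set (\<open>star_set\<close>).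
\<close>

section \<open>Pairs and levels of a superstructure\<close>

lemma set_of_eqI: "\<not> atom z \<Longrightarrow> elts z = X \<Longrightarrow> set_of X = z"
  unfolding set_of_def by (rule the_equality) (auto intro: extensionality)

lemma set_of_doubleton:
  fixes x y :: "'v::set_universe"
  shows "\<not> atom (set_of {x, y})" "elts (set_of {x, y}) = {x, y}"
  using pairing[of x y] set_of_eqI[of _ "{x, y}"] by auto

lemma set_of_singleton:
  fixes x :: "'v::set_universe"
  shows "elts (set_of {x}) = {x}"
  using set_of_doubleton(2)[of x x] by simp

lemma elts_pair: "elts (pair a b) = {set_of {a}, set_of {a, b}}"
  unfolding pair_def by (rule set_of_doubleton)

lemma pair_eq_iff: "pair a b = pair c d \<longleftrightarrow> a = c \<and> b = d"
proof
  assume "pair a b = pair c d"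
  then have "{set_of {a}, set_of {a, b}} = {set_of {c}, set_of {c, d}}"
    by (metis elts_pair)
  then have "elts ` {set_of {a}, set_of {a, b}} = elts ` {set_of {c}, set_of {c, d}}"
    by simp
  then have "{{a}, {a, b}} = {{c}, {c, d}}"
    by (simp add: set_of_singleton set_of_doubleton)
  then show "a = c \<and> b = d"
    by (auto simp: doubleton_eq_iff)
qed simp

lemma doubleton_in_level:
  "a \<in> level S n \<Longrightarrow> b \<in> level S n \<Longrightarrow> set_of {a, b} \<in> level S (Suc n)"
  by (simp add: set_of_doubleton)

lemma pair_in_level:
  assumes "a \<in> level S n" "b \<in> level S n"
  shows "pair a b \<in> level S (Suc (Suc n))"
proof -
  have "set_of {a} \<in> level S (Suc n)"
    using doubleton_in_level[OF assms(1) assms(1)] by (simp only: insert_absorb2)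
  moreover have "set_of {a, b} \<in> level S (Suc n)"
    using assms by (rule doubleton_in_level)
  ultimately show ?thesis
    unfolding pair_def by (rule doubleton_in_level)
qed

lemma triple_in_level:
  assumes "a \<in> level S n" "b \<in> level S n" "c \<in> level S n"
  shows "triple a b c \<in> level S (Suc (Suc (Suc (Suc n))))"
proof -
  have "c \<in> level S (Suc (Suc n))"
    using assms(3) by simp
  then show ?thesis
    unfolding triple_def using pair_in_level[OF pair_in_level[OF assms(1,2)]] by blast
qed

lemma set_in_hatI: "\<not> atom A \<Longrightarrow> elts A \<subseteq> level S n \<Longrightarrow> A \<in> hat S"
  unfolding hat_def by (auto intro!: exI[of _ "Suc n"])

lemma elts_subset_level:
  assumes "base_set S" "A \<in> level S n"
  shows "elts A \<subseteq> level S n"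
  using assms(2)
proof (induction n)
  case 0
  then show ?case using assms(1) elts_atom unfolding base_set_def by fastforce
qed auto

lemma hat_minus_base_not_atom:
  assumes "A \<in> hat S - elts S"
  shows "\<not> atom A"
proof -
  have "A \<in> level S n \<Longrightarrow> A \<notin> elts S \<Longrightarrow> \<not> atom A" for n
    by (induction n) auto
  then show ?thesis using assms unfolding hat_def by auto
qed

lemma base_set_in_hat: "base_set S \<Longrightarrow> S \<in> hat S"
  by (rule set_in_hatI[of _ _ 0]) (auto simp: base_set_def)


section \<open>Transfer to the images of sets\<close>

text \<open>That \<open>star A\<close> is not an atom cannot be read off from the elements of \<open>A\<close>, since the empty
  set and an atom have the same elements; it comes from transferring \<open>A \<notin> S\<close>.\<close>
lemma star_set:
  assumes "enlargement S W star" "A \<in> hat S" "\<not> atom A"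
  shows "star A \<in> hat W - elts W" "\<not> atom (star A)"
proof -
  have base: "base_set S" and W: "star S = W" and tr: "transfer_principle S star"
    and sub: "star ` hat S \<subseteq> hat W"
    using assms(1) unfolding enlargement_def by auto
  let ?\<phi> = "Neg (Mem (Const A) (Const S))"
  have "statement_in S ?\<phi>"
    using assms(2) base_set_in_hat[OF base] by (simp add: statement_in_def)
  moreover have "holds ?\<phi>"
    using base assms(3) by (auto simp: holds_def base_set_def)
  ultimately have "holds (map_fm star ?\<phi>)"
    using tr unfolding transfer_principle_def by blast
  then have "star A \<notin> elts W"
    by (simp add: holds_def W)
  then show *: "star A \<in> hat W - elts W"
    using sub assms(2) by auto
  show "\<not> atom (star A)"
    using hat_minus_base_not_atom[OF *] .
qed


section \<open>The category axioms as a bounded sentence\<close>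

definition Imp :: "'c fm \<Rightarrow> 'c fm \<Rightarrow> 'c fm" where
  "Imp \<phi> \<psi> = Neg (And \<phi> (Neg \<psi>))"

definition BEx :: "nat \<Rightarrow> 'c tm \<Rightarrow> 'c fm \<Rightarrow> 'c fm" where
  "BEx i t \<phi> = Neg (BAll i t (Neg \<phi>))"

definition Triple :: "'c tm \<Rightarrow> 'c tm \<Rightarrow> 'c tm \<Rightarrow> 'c tm" where
  "Triple r s t = Pair (Pair r s) t"

lemma sat_Imp: "sat e (Imp \<phi> \<psi>) \<longleftrightarrow> (sat e \<phi> \<longrightarrow> sat e \<psi>)"
  by (simp add: Imp_def)

lemma sat_BEx: "sat e (BEx i t \<phi>) \<longleftrightarrow> (\<exists>a\<in>elts (eval e t). sat (e(i := a)) \<phi>)"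
  by (simp add: BEx_def)

lemma eval_Triple: "eval e (Triple r s t) = triple (eval e r) (eval e s) (eval e t)"
  by (simp add: Triple_def triple_def)

text \<open>The sentence saying that the elements of \<open>f\<close> are pairs forming a map from \<open>A\<close> to \<open>B\<close>; it
  does not say that \<open>f\<close> is a set.\<close>
definition is_map_fm :: "'c \<Rightarrow> 'c \<Rightarrow> 'c \<Rightarrow> 'c fm" where
  "is_map_fm f A B =
    And (BAll 0 (Const f) (BEx 1 (Const A) (BEx 2 (Const B) (Eq (Var 0) (Pair (Var 1) (Var 2))))))
        (BAll 0 (Const A) (BEx 1 (Const B) (And (Mem (Pair (Var 0) (Var 1)) (Const f))
          (BAll 2 (Const B) (Imp (Mem (Pair (Var 0) (Var 2)) (Const f)) (Eq (Var 2) (Var 1)))))))"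

text \<open>The condition on \<open>b\<close> in the definition of a map is unbounded; it may be restricted to the
  codomain, since every pair in \<open>f\<close> has its second component there.\<close>
lemma is_map_iff_sat:
  fixes f :: "'v::set_universe"
  shows "is_map f A B \<longleftrightarrow> \<not> atom f \<and> sat e (is_map_fm f A B)"
proof -
  have "is_map f A B \<longleftrightarrow> \<not> atom f \<and>
      (\<forall>x\<in>elts f. \<exists>a\<in>elts A. \<exists>b\<in>elts B. x = pair a b) \<and>
      (\<forall>a\<in>elts A. \<exists>!b. pair a b \<in> elts f)"
    unfolding is_map_def by blast
  also have "\<dots> \<longleftrightarrow> \<not> atom f \<and>
      (\<forall>x\<in>elts f. \<exists>a\<in>elts A. \<exists>b\<in>elts B. x = pair a b) \<and>
      (\<forall>a\<in>elts A. \<exists>b\<in>elts B. pair a b \<in> elts f \<and> (\<forall>b'\<in>elts B. pair a b' \<in> elts f \<longrightarrow> b' = b))"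
    (is "_ \<and> ?pairs \<and> ?unique \<longleftrightarrow> _ \<and> _ \<and> ?bounded")
  proof -
    have "?unique \<longleftrightarrow> ?bounded" if ?pairs
    proof -
      have "b \<in> elts B" if "pair a b \<in> elts f" for a b
        using \<open>?pairs\<close> that by (metis pair_eq_iff)
      then show ?thesis by (metis (no_types))
    qed
    then show ?thesis by blast
  qed
  finally show ?thesis
    by (simp add: is_map_fm_def sat_Imp sat_BEx)
qed

text \<open>The sentence stating all axioms of a small category with morphism set \<open>M\<close>, source \<open>s\<close>,
  target \<open>t\<close> and composition \<open>c\<close>, except those saying that \<open>M\<close>, \<open>s\<close>, \<open>t\<close> and \<open>c\<close> are sets and
  that \<open>M\<close> lies in the superstructure.  The last conjunct writes the equivalence in the
  associativity axiom as two implications.\<close>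
definition category_fm :: "'c \<Rightarrow> 'c \<Rightarrow> 'c \<Rightarrow> 'c \<Rightarrow> 'c fm" where
  "category_fm M s t c =
    (let
       all = (\<lambda>i. BAll i (Const M)); ex = (\<lambda>i. BEx i (Const M));
       src = App (Const s); tgt = App (Const t);
       comp = (\<lambda>i j k. Mem (Triple i j k) (Const c));
       f = Var 0; g = Var 1; h = Var 2; u = Var 3; v = Var 4; w = Var 5; x = Var 6
     in
     And (is_map_fm s M M) (And (is_map_fm t M M)
    (And (all 0 (And (Eq (src (src f)) (src f)) (And (Eq (tgt (src f)) (src f))
                (And (Eq (src (tgt f)) (tgt f)) (Eq (tgt (tgt f)) (tgt f))))))
    (And (BAll 6 (Const c) (ex 0 (ex 1 (ex 2 (Eq x (Triple f g h))))))
    (And (all 0 (all 1 (all 2 (Imp (comp f g h)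
            (And (Eq (src f) (tgt g)) (And (Eq (tgt f) (tgt h)) (Eq (src g) (src h))))))))
    (And (all 0 (all 1 (Imp (Eq (src f) (tgt g))
            (ex 2 (And (comp f g h) (all 3 (Imp (comp f g u) (Eq u h))))))))
    (And (all 0 (And (comp f (src f) f) (comp (tgt f) f f)))
         (all 0 (all 1 (all 2 (all 3 (all 4 (all 5 (Imp (comp f g u) (Imp (comp g h v)
            (And (Imp (comp u h w) (comp f v w)) (Imp (comp f v w) (comp u h w))))))))))))))))))"

lemma map_category_fm:
  "map_fm k (category_fm M s t c) = category_fm (k M) (k s) (k t) (k c)"
  by (simp add: category_fm_def is_map_fm_def Imp_def BEx_def Triple_def Let_def)

lemma fv_category_fm: "fv (category_fm M s t c) = {}"
  by (auto simp: category_fm_def is_map_fm_def Imp_def BEx_def Triple_def Let_def)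

lemma set_category_fm: "set_fm (category_fm M s t c) = {M, s, t, c}"
  by (auto simp: category_fm_def is_map_fm_def Imp_def BEx_def Triple_def Let_def)

lemma small_category_iff_sat:
  fixes S :: "'v::set_universe"
  shows "small_category S C \<longleftrightarrow>
    Mor C \<in> hat S - elts S \<and> \<not> atom (src C) \<and> \<not> atom (tgt C) \<and> \<not> atom (cmp C) \<and>
    sat e (category_fm (Mor C) (src C) (tgt C) (cmp C))"
proof -
  have sub: "X \<subseteq> {triple f g h | f g h. f \<in> M \<and> g \<in> M \<and> h \<in> M} \<longleftrightarrow>
      (\<forall>x\<in>X. \<exists>f\<in>M. \<exists>g\<in>M. \<exists>h\<in>M. x = triple f g h)" for X M :: "'v set"
    by blast
  have ex1: "(\<exists>!h. h \<in> M \<and> P h) \<longleftrightarrow> (\<exists>h\<in>M. P h \<and> (\<forall>u\<in>M. P u \<longrightarrow> u = h))"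
    for M :: "'v set" and P
    by blast
  have iff: "(P \<longleftrightarrow> Q) \<longleftrightarrow> (P \<longrightarrow> Q) \<and> (Q \<longrightarrow> P)" for P Q
    by blast
  \<comment> \<open>Once the formula is evaluated, both sides differ only in the order of the conjuncts.\<close>
  show ?thesis
    unfolding small_category_def Let_def sub ex1 is_map_iff_sat[where e = e]
      category_fm_def sat_Imp sat_BEx eval_Triple sat.simps eval.simps
      iff[of "triple _ _ _ \<in> elts (cmp C)"]
    by (simp only: fun_upd_apply conj_ac if_True if_False simp_thms
      zero_neq_one one_neq_zero zero_neq_numeral numeral_eq_iff numeral_eq_one_iff
      one_eq_numeral_iff num.distinct num.inject numeral_neq_zero)
qed


section \<open>Transfer of small categories\<close>

lemma small_category_in_hat:
  assumes "base_set S" "small_category S C"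
  shows "Mor C \<in> hat S" "src C \<in> hat S" "tgt C \<in> hat S" "cmp C \<in> hat S"
proof -
  show "Mor C \<in> hat S"
    using assms(2) unfolding small_category_def Let_def by blast
  then obtain n where "Mor C \<in> level S n"
    unfolding hat_def by blast
  then have level: "elts (Mor C) \<subseteq> level S n"
    by (rule elts_subset_level[OF assms(1)])
  have map: "f \<in> hat S" if "is_map f (Mor C) (Mor C)" for f
  proof (rule set_in_hatI)
    show "\<not> atom f" using that unfolding is_map_def by blast
    have "elts f \<subseteq> {pair a b | a b. a \<in> elts (Mor C) \<and> b \<in> elts (Mor C)}"
      using that unfolding is_map_def by (elim conjE)
    also have "\<dots> \<subseteq> level S (Suc (Suc n))"
      using pair_in_level subsetD[OF level] by blast
    finally show "elts f \<subseteq> level S (Suc (Suc n))" .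
  qed
  show "src C \<in> hat S" "tgt C \<in> hat S"
    using map assms(2) unfolding small_category_def Let_def by blast+
  have "\<not> atom (cmp C)"
    and "elts (cmp C) \<subseteq> {triple f g h | f g h.
           f \<in> elts (Mor C) \<and> g \<in> elts (Mor C) \<and> h \<in> elts (Mor C)}"
    using assms(2) unfolding small_category_def Let_def by blast+
  moreover from this(2) have "elts (cmp C) \<subseteq> level S (Suc (Suc (Suc (Suc n))))"
    using triple_in_level subsetD[OF level] by blast
  ultimately show "cmp C \<in> hat S"
    by (blast intro: set_in_hatI)
qed

lemma small_category_star_cat:
  assumes enl: "enlargement S W star" and C: "small_category S C"
  shows "small_category W (star_cat star C)"
proof -
  have base: "base_set S" and tr: "transfer_principle S star"
    using enl unfolding enlargement_def by auto
  note in_hat = small_category_in_hat[OF base C]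
  let ?\<phi> = "category_fm (Mor C) (src C) (tgt C) (cmp C)"
  have "statement_in S ?\<phi>"
    using in_hat by (simp add: statement_in_def fv_category_fm set_category_fm)
  moreover have "holds ?\<phi>"
    using C small_category_iff_sat unfolding holds_def by blast
  ultimately have "holds (map_fm star ?\<phi>)"
    using tr unfolding transfer_principle_def by blast
  moreover have "\<not> atom (Mor C)" "\<not> atom (src C)" "\<not> atom (tgt C)" "\<not> atom (cmp C)"
    using C small_category_iff_sat hat_minus_base_not_atom by blast+
  ultimately show ?thesis
    using star_set[OF enl] in_hat
    by (simp add: small_category_iff_sat[where e = undefined] star_cat_def holds_def map_category_fm)
qed

theorem proposition2p6:
  fixes S :: "'v::set_universe" and star :: "'v \<Rightarrow> 'v" and C :: "'v cat"
  assumes "enlargement S (star S) star"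
    and "small_category S C"
  shows "small_category (star S) (star_cat star C) \<and>
         Mor (star_cat star C) = star (Mor C) \<and>
         elts (Mor (star_cat star C)) \<subseteq> internal S star"
proof (intro conjI)
  show "small_category (star S) (star_cat star C)"
    using assms by (rule small_category_star_cat)
  show "Mor (star_cat star C) = star (Mor C)"
    by (simp add: star_cat_def)
  moreover have "Mor C \<in> hat S - elts S"
    using assms(2) unfolding small_category_def Let_def by blast
  ultimately show "elts (Mor (star_cat star C)) \<subseteq> internal S star"
    unfolding internal_def by auto
qed

end
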